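(* Consider $m$ clients with data amounts $N_i$, sharing costs $c_i$, data-eagerness levels $K_i$, and local models $\theta_1^t,\dots,\theta_m^t$ at each round $t\in[T]$. Suppose that the sharing graph $\mathbf{A}^t=(a^t_{ij})_{m\times m}$, with rows $\mathbf{a}^t_1,\dots,\mathbf{a}^t_m$, is given by the graph topology learning algorithm described in the context (run for every client $i$ on the models $\theta^t_1,\dots,\theta^t_m$), and that $p_i^t$ is the payment described in the context. Then for all $i\in[m]$ and $t\in[T]$, $$U_i^t=G_i(\mathbf{a}^t_i)-\sum_{j\in[m]}a^t_{ji}c_i-p^t_i\ \ge\ 0.$$
   Context: Setting. There are $m$ clients, $[m]=\{1,\dots,m\}$; $T$ is the number of rounds and $[T]=\{1,\dots,T\}$. Client $i$ has a data amount $N_i$ (a positive integer), a cost $c_i\ge 0$ (real) incurred each time another client imports its model, and a data-eagerness level $K_i\ge 0$ (real). At round $t$ client $i$ has model parameters $\theta_i^t$ (a real vector, of the same dimension for all clients). $d(\cdot,\cdot)\ge 0$ is a fixed differentiable real-valued function measuring the difference between two models, and $\lambda>0$ is a fixed constant. Sharing graph. $\mathbf{A}^t=(a^t_{ij})\in\{0,1\}^{m\times m}$, where $a^t_{ij}=1$ iff $i\ne j$ and client $i$ imports the model of client $j$ in round $t$ (so $a^t_{ii}=0$). $\mathbf{a}^t_i$ is the $i$-th row of $\mathbf{A}^t$, and $\mathbf{e}_j$ is the $j$-th row of the identity matrix. Collaboration gain. $G_i(\mathbf{a}_i)=g_i\big(\sum_{j\in[m]}a_{ij}N_j\big)$, where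 $g_i(x)=\sqrt{K_i/N_i}-\sqrt{K_i/(N_i+x)}$ for $x>-N_i$. Payment. The remittance from client $i$ to client $j$ is $$r^t_{ij}=a^t_{ij}\Big[G_i(\mathbf{a}^t_i)-G_i(\mathbf{a}^t_i-\mathbf{e}_j)-\lambda\tfrac{N_j}{N_i}d(\theta^t_i,\theta^t_j)\Big]$$ (equal to $0$ when $a^t_{ij}=0$), and the overall payment of client $i$ is $p^t_i=\sum_{j\in[m]}r^t_{ij}-\sum_{j\in[m]}r^t_{ji}$. Utility. $U_i^t=G_i(\mathbf{a}^t_i)-\sum_{j\in[m]}a^t_{ji}c_i-p^t_i$. Graph topology learning algorithm (computes the row $\mathbf{a}_i$ of client $i$ at round $t$). For each $j\ne i$ calculate a threshold $N^{Th}_j$ by solving, over the real values at which both terms on the left are defined (i.e. $N^{Th}_j>N_j-N_i$), $$g_i(N^{Th}_j)-g_i(N^{Th}_j-N_j)=c_j+\lambda\tfrac{N_j}{N_i}d(\theta_i^t,\theta_j^t).$$ If there is no solution, set $N^{Th}_j=0$. If $K_i=0$, also set $N^{Th}_j=0$ (a client with $K_i=0$ imports no model). Then initialize $\mathbf{a}_i=\mathbf{0}$, $n=0$, and repeat as long as there is a $j\neq i$ with $a_{ij}=0$: let $k$ be an index with the largest $N^{Th}_k$ among all $k\ne i$ with $a_{ik}=0$ (ties broken by a fixed order on the clients); if $n+N_k<N^{Th}_k$, set $a_{ik}=1$ and $n\leftarrow n+N_k$; otherwise stop. Output $\mathbf{a}_i$. *)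

theory Defs
  imports "HOL-Analysis.Analysis"
begin

text \<open>
  The set of clients is a finite type \<open>'m\<close>, so that \<open>m = CARD('m)\<close>; its class order is the fixed
  order used to break ties.  Rows of a sharing graph are vectors of type \<open>real ^ 'm\<close>, and
  \<open>axis j 1\<close> is the unit vector \<open>e\<^sub>j\<close>.  The models of all clients at one round are given by
  \<open>\<theta> :: 'm \<Rightarrow> real ^ 'p\<close>.
\<close>

text \<open>Meaningful for \<open>x > - N i\<close> only.\<close>

definition gain_fun :: "('m \<Rightarrow> nat) \<Rightarrow> ('m \<Rightarrow> real) \<Rightarrow> 'm \<Rightarrow> real \<Rightarrow> real" where
  "gain_fun N K i x = sqrt (K i / real (N i)) - sqrt (K i / (real (N i) + x))"

definition gain :: "('m::finite \<Rightarrow> nat) \<Rightarrow> ('m \<Rightarrow> real) \<Rightarrow> 'm \<Rightarrow> real ^ 'm \<Rightarrow> real" where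
  "gain N K i a = gain_fun N K i (\<Sum>j\<in>UNIV. a $ j * real (N j))"

text \<open>
  The value of \<open>a\<^sub>i - e\<^sub>j\<close> may lie outside the domain of the gain only if \<open>a\<^sub>i\<^sub>j = 0\<close>, and then
  the factor \<open>A $ i $ j\<close> makes the remittance zero.
\<close>

definition remittance ::
    "real \<Rightarrow> (real ^ 'p \<Rightarrow> real ^ 'p \<Rightarrow> real) \<Rightarrow> ('m::finite \<Rightarrow> nat) \<Rightarrow> ('m \<Rightarrow> real) \<Rightarrow>
     ('m \<Rightarrow> real ^ 'p) \<Rightarrow> real ^ 'm ^ 'm \<Rightarrow> 'm \<Rightarrow> 'm \<Rightarrow> real" where
  "remittance lam d N K \<theta> A i j =
     A $ i $ j * (gain N K i (A $ i) - gain N K i (A $ i - axis j 1)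
                  - lam * (real (N j) / real (N i)) * d (\<theta> i) (\<theta> j))"

definition payment ::
    "real \<Rightarrow> (real ^ 'p \<Rightarrow> real ^ 'p \<Rightarrow> real) \<Rightarrow> ('m::finite \<Rightarrow> nat) \<Rightarrow> ('m \<Rightarrow> real) \<Rightarrow>
     ('m \<Rightarrow> real ^ 'p) \<Rightarrow> real ^ 'm ^ 'm \<Rightarrow> 'm \<Rightarrow> real" where
  "payment lam d N K \<theta> A i =
     (\<Sum>j\<in>UNIV. remittance lam d N K \<theta> A i j) - (\<Sum>j\<in>UNIV. remittance lam d N K \<theta> A j i)"

definition utility ::
    "real \<Rightarrow> (real ^ 'p \<Rightarrow> real ^ 'p \<Rightarrow> real) \<Rightarrow> ('m::finite \<Rightarrow> nat) \<Rightarrow> ('m \<Rightarrow> real) \<Rightarrow> ('m \<Rightarrow> real) \<Rightarrow>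
     ('m \<Rightarrow> real ^ 'p) \<Rightarrow> real ^ 'm ^ 'm \<Rightarrow> 'm \<Rightarrow> real" where
  "utility lam d N c K \<theta> A i =
     gain N K i (A $ i) - (\<Sum>j\<in>UNIV. A $ j $ i * c i) - payment lam d N K \<theta> A i"

definition solves_threshold ::
    "real \<Rightarrow> (real ^ 'p \<Rightarrow> real ^ 'p \<Rightarrow> real) \<Rightarrow> ('m \<Rightarrow> nat) \<Rightarrow> ('m \<Rightarrow> real) \<Rightarrow> ('m \<Rightarrow> real) \<Rightarrow>
     ('m \<Rightarrow> real ^ 'p) \<Rightarrow> 'm \<Rightarrow> 'm \<Rightarrow> real \<Rightarrow> bool" where
  "solves_threshold lam d N c K \<theta> i j x \<longleftrightarrow>
     x > real (N j) - real (N i) \<and>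
     gain_fun N K i x - gain_fun N K i (x - real (N j))
       = c j + lam * (real (N j) / real (N i)) * d (\<theta> i) (\<theta> j)"

text \<open>
  For positive \<open>K i\<close>, \<open>N i\<close> and \<open>N j\<close> the left-hand side of the equation is strictly decreasing
  in \<open>x\<close>, so there is at most one solution to choose.
\<close>

definition threshold ::
    "real \<Rightarrow> (real ^ 'p \<Rightarrow> real ^ 'p \<Rightarrow> real) \<Rightarrow> ('m \<Rightarrow> nat) \<Rightarrow> ('m \<Rightarrow> real) \<Rightarrow> ('m \<Rightarrow> real) \<Rightarrow>
     ('m \<Rightarrow> real ^ 'p) \<Rightarrow> 'm \<Rightarrow> 'm \<Rightarrow> real" where
  "threshold lam d N c K \<theta> i j =
     (if K i = 0 \<or> (\<nexists>x. solves_threshold lam d N c K \<theta> i j x) then 0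
      else (SOME x. solves_threshold lam d N c K \<theta> i j x))"

definition candidates :: "'m::finite \<Rightarrow> real ^ 'm \<Rightarrow> 'm set" where
  "candidates i a = {k. k \<noteq> i \<and> a $ k = 0}"

definition best :: "('m::{finite,linorder} \<Rightarrow> real) \<Rightarrow> 'm set \<Rightarrow> 'm" where
  "best Th C = Min {k \<in> C. \<forall>j\<in>C. Th j \<le> Th k}"

lemma best_in:
  assumes "C \<noteq> {}"
  shows "best Th C \<in> C" and "j \<in> C \<Longrightarrow> Th j \<le> Th (best Th C)"
proof -
  let ?B = "{k \<in> C. \<forall>j\<in>C. Th j \<le> Th k}"
  have "Max (Th ` C) \<in> Th ` C" using assms by (intro Max_in) auto
  then obtain k where "k \<in> C" "Th k = Max (Th ` C)" by auto
  then have "k \<in> ?B" by simp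
  then have "best Th C \<in> ?B" unfolding best_def by (intro Min_in) auto
  then show "best Th C \<in> C" and "j \<in> C \<Longrightarrow> Th j \<le> Th (best Th C)" by auto
qed

function topology_loop ::
    "('m \<Rightarrow> nat) \<Rightarrow> ('m \<Rightarrow> real) \<Rightarrow> 'm \<Rightarrow> real ^ ('m::{finite,linorder}) \<Rightarrow> nat \<Rightarrow>
     real ^ ('m::{finite,linorder})" where
  "topology_loop N Th i a n =
     (if candidates i a = {} then a
      else let k = best Th (candidates i a) in
        if real (n + N k) < Th k
        then topology_loop N Th i (\<chi> j. if j = k then 1 else a $ j) (n + N k)
        else a)"
  by pat_completeness auto
termination
proof (relation "Wellfounded.measure (\<lambda>(N, Th, i, a, n). card (candidates i a))", goal_cases)
  case 1
  show ?case by simp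
next
  case (2 N Th i a n k)
  from 2 have "k \<in> candidates i a" by (simp add: best_in)
  then have "candidates i (\<chi> j. if j = k then 1 else a $ j) \<subset> candidates i a"
    by (auto simp: candidates_def split: if_splits)
  then show ?case by (simp add: psubset_card_mono)
qed

declare topology_loop.simps [simp del]

definition topology_row ::
    "real \<Rightarrow> (real ^ 'p \<Rightarrow> real ^ 'p \<Rightarrow> real) \<Rightarrow> ('m \<Rightarrow> nat) \<Rightarrow> ('m \<Rightarrow> real) \<Rightarrow> ('m \<Rightarrow> real) \<Rightarrow>
     ('m \<Rightarrow> real ^ 'p) \<Rightarrow> 'm \<Rightarrow> real ^ ('m::{finite,linorder})" where
  "topology_row lam d N c K \<theta> i = topology_loop N (threshold lam d N c K \<theta> i) i 0 0"

end

(* A client's utility splits into what it keeps as an importer and what it earns as an exporter, and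
   both parts are nonnegative because g_i has diminishing returns.  As an importer, client i pays at
   most the marginal gain of each imported model on top of all the others; adding the models one by
   one shows that these marginal gains sum to at most G_i.  As an exporter to j, client i needs
   r_ji >= c_i.  The greedy algorithm examines the thresholds in decreasing order, so the final total
   of j lies below the threshold of every model it imports; by diminishing returns the marginal gain
   of such a model is at least its value at the threshold, which is c_i plus the distance penalty. *)

theory Submission
  imports Defs
begin

text \<open>Rationalizing the difference leaves \<open>p\<close> only in the denominator, in factors
  that grow with \<open>p\<close>; this makes monotonicity in \<open>p\<close> immediate.\<close>

lemma inverse_sqrt_diff:
  fixes p n :: real
  assumes "p > 0" "n \<ge> 0"
  shows "1 / sqrt p - 1 / sqrt (p + n) = n / (sqrt p * sqrt (p + n) * (sqrt p + sqrt (p + n)))"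
proof -
  define u v where "u = sqrt p" and "v = sqrt (p + n)"
  have "u > 0" "v > 0" and n: "n = v * v - u * u"
    using assms by (auto simp: u_def v_def)
  then have "u * v * (u + v) \<noteq> 0" by simp
  have "1 / u - 1 / v = (v - u) / (u * v)"
    using \<open>u > 0\<close> \<open>v > 0\<close> by (simp add: field_simps)
  also have "\<dots> = ((v - u) * (u + v)) / (u * v * (u + v))"
    using \<open>u > 0\<close> \<open>v > 0\<close> by (subst mult_divide_mult_cancel_right) auto
  also have "(v - u) * (u + v) = n" unfolding n by algebra
  finally show ?thesis unfolding u_def v_def .
qed

lemma inverse_sqrt_diff_antimono:
  fixes p q n :: real
  assumes "0 < p" "p \<le> q" "0 \<le> n"
  shows "1 / sqrt q - 1 / sqrt (q + n) \<le> 1 / sqrt p - 1 / sqrt (p + n)"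
proof -
  have "n / (sqrt q * sqrt (q + n) * (sqrt q + sqrt (q + n)))
      \<le> n / (sqrt p * sqrt (p + n) * (sqrt p + sqrt (p + n)))"
    using assms by (intro divide_left_mono mult_mono add_mono mult_pos_pos add_pos_pos) auto
  then show ?thesis
    using assms by (simp only: inverse_sqrt_diff)
qed

lemma gain_fun_zero [simp]: "gain_fun N K i 0 = 0"
  by (simp add: gain_fun_def)

text \<open>With base point \<open>p = N i + (z - n)\<close>, the increment is
  \<open>sqrt (K i)\<close> times a difference that decreases in \<open>p\<close>. The last premise
  keeps \<open>p\<close> positive at \<open>x\<close>, hence also at \<open>y\<close>.\<close>

lemma gain_fun_diminishing:
  assumes "K i \<ge> 0" "n \<ge> 0" "x \<le> y" "x - n > - real (N i)"
  shows "gain_fun N K i y - gain_fun N K i (y - n) \<le> gain_fun N K i x - gain_fun N K i (x - n)"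
proof -
  have diff: "gain_fun N K i z - gain_fun N K i (z - n)
      = sqrt (K i) * (1 / sqrt (N i + (z - n)) - 1 / sqrt (N i + (z - n) + n))" for z
    by (simp add: gain_fun_def real_sqrt_divide right_diff_distrib)
  show ?thesis
    unfolding diff using assms
    by (intro mult_left_mono inverse_sqrt_diff_antimono) auto
qed

lemma sum_marginal_le_gain_fun:
  assumes "K i \<ge> 0" "N i > 0" "finite S" "(\<Sum>j\<in>S. real (N j)) \<le> y"
  shows "(\<Sum>j\<in>S. gain_fun N K i y - gain_fun N K i (y - real (N j)))
       \<le> gain_fun N K i (\<Sum>j\<in>S. real (N j))"
  using assms(3,4)
proof (induction S)
  case empty
  show ?case by simp
next
  case (insert k S)
  let ?s = "\<Sum>j\<in>S. real (N j)"
  have "?s \<ge> 0" by (intro sum_nonneg) auto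
  \<comment> \<open>Moving the marginal gain of \<open>k\<close> from \<open>y\<close> down to the
    partial total turns it into g(?s + N k) - g(?s), which telescopes with the induction
    hypothesis.\<close>
  then have "gain_fun N K i y - gain_fun N K i (y - real (N k))
      \<le> gain_fun N K i (?s + N k) - gain_fun N K i (?s + N k - real (N k))"
    using insert.prems insert.hyps assms(1,2) by (intro gain_fun_diminishing) (auto simp: add.commute)
  moreover have "?s \<le> y" using insert.prems insert.hyps by simp
  ultimately show ?case using insert.IH insert.hyps by (simp add: add.commute)
qed

lemma gain_minus_axis:
  "gain N K i (a - axis j 1) = gain_fun N K i ((\<Sum>l\<in>UNIV. a $ l * real (N l)) - real (N j))"
proof -
  have "(\<Sum>l\<in>UNIV. axis j 1 $ l * real (N l)) = real (N j)"
    by (simp add: axis_def if_distrib[of "\<lambda>x. x * _"] cong: if_cong)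
  then show ?thesis
    by (simp add: gain_def left_diff_distrib sum_subtractf)
qed

text \<open>The loop invariant, and all that the utility bound needs to know about the algorithm's
  output.\<close>

definition admissible_row :: "('m::finite \<Rightarrow> nat) \<Rightarrow> ('m \<Rightarrow> real) \<Rightarrow> real ^ 'm \<Rightarrow> bool" where
  "admissible_row N Th a \<longleftrightarrow>
     (\<forall>j. a $ j = 0 \<or> a $ j = 1) \<and>
     (\<forall>j. a $ j = 1 \<longrightarrow> (\<Sum>l\<in>UNIV. a $ l * real (N l)) < Th j)"

text \<open>
  The last premise records that models are imported in decreasing order of their thresholds, so that
  testing the new total against the threshold of the newest model suffices.
\<close>

lemma topology_loop_admissible:
  fixes a :: "real ^ 'm::{finite,linorder}"
  assumes "admissible_row N Th a"
    and "real n = (\<Sum>l\<in>UNIV. a $ l * real (N l))"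
    and "\<And>j k. a $ j = 1 \<Longrightarrow> k \<in> candidates i a \<Longrightarrow> Th k \<le> Th j"
  shows "admissible_row N Th (topology_loop N Th i a n)"
  using assms
proof (induction N Th i a n rule: topology_loop.induct)
  case (1 N Th i a n)
  define k where "k = best Th (candidates i a)"
  define b where "b = (\<chi> j. if j = k then 1 else a $ j)"
  show ?case
  proof (cases "candidates i a \<noteq> {} \<and> real (n + N k) < Th k")
    case False
    then show ?thesis
      using "1.prems"(1) by (subst topology_loop.simps) (auto simp: k_def Let_def)
  next
    case True
    then have k: "k \<in> candidates i a" and max: "\<And>j. j \<in> candidates i a \<Longrightarrow> Th j \<le> Th k"
      unfolding k_def using best_in by blast+
    have "a $ k = 0" using k by (simp add: candidates_def)
    then have "b $ l * real (N l) = a $ l * real (N l) + (if l = k then real (N l) else 0)" for l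
      by (simp add: b_def)
    then have total: "real (n + N k) = (\<Sum>l\<in>UNIV. b $ l * real (N l))"
      using "1.prems"(2) by (simp add: sum.distrib)
    have adm: "admissible_row N Th b"
      unfolding admissible_row_def
    proof (intro conjI allI impI)
      show "b $ j = 0 \<or> b $ j = 1" for j
        using "1.prems"(1) by (simp add: b_def admissible_row_def)
      fix j assume "b $ j = 1"
      \<comment> \<open>The loop test bounds the new total by \<open>Th k\<close>; earlier imports
        have thresholds at least as large.\<close>
      then have "Th k \<le> Th j"
        using "1.prems"(3) k by (cases "j = k") (auto simp: b_def)
      then show "(\<Sum>l\<in>UNIV. b $ l * real (N l)) < Th j"
        using True total by linarith
    qed
    \<comment> \<open>Candidates only disappear, so the old ordering persists; for the new index
      \<open>k\<close> it holds because \<open>k\<close> was a maximizer.\<close>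
    have order: "Th l \<le> Th j" if "b $ j = 1" "l \<in> candidates i b" for j l
    proof -
      have "l \<in> candidates i a"
        using that(2) by (auto simp: b_def candidates_def split: if_splits)
      then show ?thesis
        using that(1) max "1.prems"(3) by (cases "j = k") (auto simp: b_def)
    qed
    have "topology_loop N Th i a n = topology_loop N Th i b (n + N k)"
      using True by (subst topology_loop.simps) (simp add: k_def b_def Let_def)
    moreover have "admissible_row N Th (topology_loop N Th i b (n + N k))"
      using "1.IH"[OF _ k_def, folded b_def] True adm total order by blast
    ultimately show ?thesis by simp
  qed
qed

text \<open>The loop starts from the zero row, where the invariant and the ordering premise are
  vacuous.\<close>

lemma topology_row_admissible:
  "admissible_row N (threshold lam d N c K \<theta> i) (topology_row lam d N c K \<theta> i)"
  unfolding topology_row_def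
  by (rule topology_loop_admissible) (auto simp: admissible_row_def)

lemma solves_threshold_threshold:
  assumes "threshold lam d N c K \<theta> i j \<noteq> 0"
  shows "solves_threshold lam d N c K \<theta> i j (threshold lam d N c K \<theta> i j)"
  using assms unfolding threshold_def by (auto split: if_splits intro: someI)

lemma admissible_row_ge:
  assumes "admissible_row N Th a" "a $ j = 1"
  shows "real (N j) \<le> (\<Sum>l\<in>UNIV. a $ l * real (N l))"
proof -
  have "0 \<le> a $ l * real (N l)" for l
    using assms(1) unfolding admissible_row_def by (metis mult_nonneg_nonneg of_nat_0_le_iff order_refl zero_le_one)
  then have "a $ j * real (N j) \<le> (\<Sum>l\<in>UNIV. a $ l * real (N l))"
    by (intro member_le_sum) auto
  then show ?thesis using assms(2) by simp
qed

lemma remittance_ge_cost: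
  assumes "admissible_row N (threshold lam d N c K \<theta> i) (A $ i)" "N i > 0" "K i \<ge> 0"
  shows "A $ i $ j * c j \<le> remittance lam d N K \<theta> A i j"
proof (cases "A $ i $ j = 1")
  case False
  then have "A $ i $ j = 0" using assms(1) by (auto simp: admissible_row_def)
  then show ?thesis by (simp add: remittance_def)
next
  case True
  define X where "X = (\<Sum>l\<in>UNIV. A $ i $ l * real (N l))"
  define Th where "Th = threshold lam d N c K \<theta> i j"
  have X: "real (N j) \<le> X" "X < Th"
    using admissible_row_ge[OF assms(1) True] assms(1) True
    by (auto simp: X_def Th_def admissible_row_def)
  \<comment> \<open>Since \<open>Th > X \<ge> 0\<close>, \<open>Th\<close> is not the default value
    0 and so is a genuine solution.\<close>
  then have "solves_threshold lam d N c K \<theta> i j Th"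
    unfolding Th_def by (intro solves_threshold_threshold) auto
  then have "gain_fun N K i Th - gain_fun N K i (Th - real (N j))
      = c j + lam * (real (N j) / real (N i)) * d (\<theta> i) (\<theta> j)"
    by (simp add: solves_threshold_def)
  \<comment> \<open>The domain condition holds because
    \<open>X - N j \<ge> 0 > - N i\<close>.\<close>
  moreover have "gain_fun N K i Th - gain_fun N K i (Th - real (N j))
      \<le> gain_fun N K i X - gain_fun N K i (X - real (N j))"
    using X assms(2,3) by (intro gain_fun_diminishing) auto
  ultimately show ?thesis
    using True unfolding remittance_def gain_minus_axis by (simp add: gain_def X_def)
qed

lemma sum_remittance_le_gain:
  assumes "admissible_row N Th (A $ i)" "N i > 0" "K i \<ge> 0" "lam \<ge> 0" "\<And>x y. d x y \<ge> 0"
  shows "(\<Sum>j\<in>UNIV. remittance lam d N K \<theta> A i j) \<le> gain N K i (A $ i)"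
proof -
  define X where "X = (\<Sum>l\<in>UNIV. A $ i $ l * real (N l))"
  define S where "S = {j. A $ i $ j = 1}"
  have row: "A $ i $ j = (if j \<in> S then 1 else 0)" for j
    using assms(1) by (auto simp: S_def admissible_row_def)
  have X: "X = (\<Sum>j\<in>S. real (N j))"
    unfolding X_def row by (simp add: if_distrib[of "\<lambda>x. x * _"] sum.If_cases cong: if_cong)
  \<comment> \<open>Dropping the nonnegative distance penalty leaves the pure marginal gain at the
    final total.\<close>
  have "remittance lam d N K \<theta> A i j
      \<le> (if j \<in> S then gain_fun N K i X - gain_fun N K i (X - real (N j)) else 0)" for j
    unfolding remittance_def gain_minus_axis
    using assms(4,5) by (simp add: gain_def X_def[symmetric] row[of j])
  then have "(\<Sum>j\<in>UNIV. remittance lam d N K \<theta> A i j)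
      \<le> (\<Sum>j\<in>UNIV. if j \<in> S then gain_fun N K i X - gain_fun N K i (X - real (N j)) else 0)"
    by (intro sum_mono)
  also have "\<dots> = (\<Sum>j\<in>S. gain_fun N K i X - gain_fun N K i (X - real (N j)))"
    by (simp add: sum.If_cases)
  also have "\<dots> \<le> gain_fun N K i X"
    using assms(2,3) sum_marginal_le_gain_fun[of K i N S X] X by simp
  finally show ?thesis by (simp add: gain_def X_def)
qed

theorem theorem1:
  fixes N :: "'m::{finite,linorder} \<Rightarrow> nat"
    and c K :: "'m \<Rightarrow> real"
    and lam :: real
    and d :: "real ^ 'p \<Rightarrow> real ^ 'p \<Rightarrow> real"
    and T :: nat
    and \<theta> :: "nat \<Rightarrow> 'm \<Rightarrow> real ^ 'p"
    and A :: "nat \<Rightarrow> real ^ ('m::{finite,linorder}) ^ ('m::{finite,linorder})"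
  assumes "\<And>i. N i > 0"
    and "\<And>i. c i \<ge> 0"
    and "\<And>i. K i \<ge> 0"
    and "lam > 0"
    and "\<And>x y. d x y \<ge> 0"
    and "(\<lambda>(x, y). d x y) differentiable_on UNIV"
    and "\<And>t i. t \<in> {1..T} \<Longrightarrow> A t $ i = topology_row lam d N c K (\<theta> t) i"
  shows "\<forall>i. \<forall>t\<in>{1..T}. utility lam d N c K (\<theta> t) (A t) i \<ge> 0"
proof (intro allI ballI)
  fix i t assume t: "t \<in> {1..T}"
  have adm: "admissible_row N (threshold lam d N c K (\<theta> t) j) (A t $ j)" for j
    unfolding assms(7)[OF t] by (rule topology_row_admissible)
  have "(\<Sum>j\<in>UNIV. remittance lam d N K (\<theta> t) (A t) i j) \<le> gain N K i (A t $ i)"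
    using adm assms by (intro sum_remittance_le_gain) auto
  \<comment> \<open>Here each \<open>j\<close> is the importer and \<open>i\<close> the exporter, so
    the invariant is applied to row \<open>j\<close>.\<close>
  moreover have "(\<Sum>j\<in>UNIV. A t $ j $ i * c i) \<le> (\<Sum>j\<in>UNIV. remittance lam d N K (\<theta> t) (A t) j i)"
    using adm assms by (intro sum_mono remittance_ge_cost) auto
  ultimately show "utility lam d N c K (\<theta> t) (A t) i \<ge> 0"
    by (simp add: utility_def payment_def)
qed

end
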